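(* The smallest prime power $q$ for which there exists an optimal $\mathrm{RS}_{4,2}(\boldsymbol\alpha)$ code over $\mathbb{F}_q$ is $q=7$. In this case, a possible evaluation vector is $\boldsymbol\alpha=(0,1,2,5)\in\mathbb{F}_7^4$.
   Context: For distinct elements $\alpha_1,\ldots,\alpha_n\in\mathbb{F}_q$ and $k<n$, the Reed--Solomon code with evaluation vector $\boldsymbol\alpha=(\alpha_1,\ldots,\alpha_n)$ is $\mathrm{RS}_{n,k}(\boldsymbol\alpha)=\{(f(\alpha_1),\ldots,f(\alpha_n)) : f\in\mathbb{F}_q[x],\ \deg f<k\}\subseteq\mathbb{F}_q^n$. Evaluation vectors have pairwise distinct entries (so $q\ge n$). For strings $\mathbf{c},\mathbf{c}'$, $\mathrm{LCS}(\mathbf{c},\mathbf{c}')$ is the length of a longest common (not necessarily contiguous) subsequence, and for a code $\mathcal{C}$, $\mathrm{LCS}(\mathcal{C})=\max\{\mathrm{LCS}(\mathbf{c},\mathbf{c}'):\mathbf{c},\mathbf{c}'\in\mathcal{C},\ \mathbf{c}\ne\mathbf{c}'\}$. The half-Singleton bound states that an $[n,k]_q$ linear code $\mathcal{C}$ can correct at most $n-2k+1$ insertion/deletion errors, equivalently $\mathrm{LCS}(\mathcal{C})\ge 2k-2$. A code is called optimal if it attains this bound, i.e. $\mathrm{LCS}(\mathcal{C})=2k-2$ (for $n=4$, $k=2$: $\mathrm{LCS}(\mathcal{C})=2$, i.e. the code can correct a single insertion or deletion). *)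

theory Defs
  imports
    "HOL-Library.Sublist"
    "HOL-Algebra.Polynomials"
    "HOL-Number_Theory.Residues"
    "HOL-Number_Theory.Prime_Powers"
begin

definition evaluation_vector :: "('a, 'm) ring_scheme \<Rightarrow> nat \<Rightarrow> 'a list \<Rightarrow> bool" where
  "evaluation_vector F n \<alpha> \<longleftrightarrow> length \<alpha> = n \<and> distinct \<alpha> \<and> set \<alpha> \<subseteq> carrier F"

(* The zero polynomial [] is listed separately because its library degree is 0 rather than
   -infinity; this only makes a difference for k = 0. *)
definition RS_code :: "('a, 'm) ring_scheme \<Rightarrow> nat \<Rightarrow> 'a list \<Rightarrow> 'a list set" where
  "RS_code F k \<alpha> =
    {map (ring.eval F f) \<alpha> | f.
       f \<in> carrier (univ_poly F (carrier F)) \<and> (f = [] \<or> Polynomials.degree f < k)}"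

definition LCS :: "'a list \<Rightarrow> 'a list \<Rightarrow> nat" where
  "LCS c c' = Max {length s | s. subseq s c \<and> subseq s c'}"

definition LCS_code :: "'a list set \<Rightarrow> nat" where
  "LCS_code C = Max {LCS c c' | c c'. c \<in> C \<and> c' \<in> C \<and> c \<noteq> c'}"

(* Attaining the half-Singleton bound LCS(C) >= 2k - 2 for codes of dimension k. The subtraction
   is on nat, so this is meaningful for k >= 1. *)
definition optimal_code :: "nat \<Rightarrow> 'a list set \<Rightarrow> bool" where
  "optimal_code k C \<longleftrightarrow> LCS_code C = 2 * k - 2"

definition optimal_RS :: "('a, 'm) ring_scheme \<Rightarrow> nat \<Rightarrow> nat \<Rightarrow> 'a list \<Rightarrow> bool" where
  "optimal_RS F n k \<alpha> \<longleftrightarrow>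
     k < n \<and> evaluation_vector F n \<alpha> \<and> optimal_code k (RS_code F k \<alpha>)"

end

theory Submission
  imports Defs
begin

text \<open>
  For \<open>k = 2\<close> the codewords are the images of \<open>\<alpha>\<close> under the affine maps \<open>x \<mapsto> a x + b\<close>, and such
  maps preserve the ratio \<open>(z - x) / (y - x)\<close> of a triple. Hence some two distinct codewords share a
  subsequence of length 3 iff two distinct 3-term subsequences of \<open>\<alpha>\<close> have the same ratio.
  The ratio of a triple of distinct elements avoids \<open>0\<close> and \<open>1\<close>, so optimality at \<open>n = 4\<close> requires
  four distinct values among \<open>q - 2\<close> ones; this leaves \<open>q \<ge> 6\<close>, and \<open>6\<close> is not a prime power.
  Over the field with 7 elements the ratios of \<open>(0,1,2,5)\<close> are \<open>2, 5, 6, 4\<close>.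
\<close>

section \<open>Longest common subsequences\<close>

text \<open>\<open>Max\<close> is informative only on finite nonempty sets; here
  \<open>length c\<close> bounds every element.\<close>

lemma finite_LCS_lengths: "finite {length s | s. subseq s c \<and> subseq s c'}"
  by (rule finite_subset[of _ "{..length c}"]) (auto dest: list_emb_length)

lemma length_le_LCS:
  assumes "subseq s c" "subseq s c'"
  shows "length s \<le> LCS c c'"
  unfolding LCS_def by (rule Max_ge[OF finite_LCS_lengths]) (use assms in auto)

lemma LCS_le_iff: "LCS c c' \<le> m \<longleftrightarrow> (\<forall>s. subseq s c \<and> subseq s c' \<longrightarrow> length s \<le> m)"
proof -
  \<comment> \<open>The empty list is always a common subsequence.\<close>
  have "{length s | s. subseq s c \<and> subseq s c'} \<noteq> {}"
    using list_emb_Nil by blast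
  then show ?thesis
    unfolding LCS_def by (subst Max_le_iff[OF finite_LCS_lengths]) auto
qed

lemma LCS_le_length: "LCS c c' \<le> length c"
  unfolding LCS_le_iff by (auto dest: list_emb_length)

text \<open>The code itself may be infinite, as over an infinite field; the common block length
  still bounds all LCS values.\<close>

lemma finite_LCS_values:
  assumes "\<And>c. c \<in> C \<Longrightarrow> length c = n"
  shows "finite {LCS c c' | c c'. c \<in> C \<and> c' \<in> C \<and> c \<noteq> c'}"
  by (rule finite_subset[of _ "{..n}"]) (use assms LCS_le_length in fastforce)+

lemma LCS_le_LCS_code:
  assumes "\<And>c. c \<in> C \<Longrightarrow> length c = n" "c \<in> C" "c' \<in> C" "c \<noteq> c'"
  shows "LCS c c' \<le> LCS_code C"
  unfolding LCS_code_def by (rule Max_ge[OF finite_LCS_values[of C n]]) (use assms in auto)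

text \<open>The fixed pair \<open>c\<close>, \<open>c'\<close> witnesses that the set under
  \<open>Max\<close> is nonempty, so that bounding its elements bounds the maximum.\<close>

lemma LCS_code_le:
  assumes "\<And>c. c \<in> C \<Longrightarrow> length c = n" "c \<in> C" "c' \<in> C" "c \<noteq> c'"
    and "\<And>c c'. \<lbrakk>c \<in> C; c' \<in> C; c \<noteq> c'\<rbrakk> \<Longrightarrow> LCS c c' \<le> m"
  shows "LCS_code C \<le> m"
  unfolding LCS_code_def by (rule Max.boundedI[OF finite_LCS_values[of C n]]) (use assms in auto)

text \<open>Codewords are images of the evaluation vector, so a common subsequence of two codewords
  can be pulled back to two, possibly different, subsequences of that vector.\<close>

lemma subseq_map_imp: "subseq r (map f xs) \<Longrightarrow> \<exists>u. subseq u xs \<and> r = map f u"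
proof (induction xs arbitrary: r)
  case (Cons x xs)
  from Cons.prems consider "subseq r (map f xs)"
    | r' where "r = f x # r'" "subseq r' (map f xs)"
    by (cases r) (auto split: if_splits simp: subseq_Cons2_iff)
  then show ?case
  proof cases
    case 1
    then show ?thesis
      using Cons.IH by blast
  next
    case (2 r')
    then obtain u where "subseq u xs" "r' = map f u"
      using Cons.IH by blast
    then have "subseq (x # u) (x # xs)" "r = map f (x # u)"
      using 2 by auto
    then show ?thesis
      by blast
  qed
qed auto

section \<open>Three-term subsequences\<close>

definition subtriples :: "'a list \<Rightarrow> 'a list set" where
  "subtriples xs = {u. subseq u xs \<and> length u = 3}"

lemma finite_subtriples: "finite (subtriples xs)"
  by (rule finite_subset[of _ "set (subseqs xs)"]) (auto simp: subtriples_def)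

lemma subtriplesE:
  assumes "u \<in> subtriples xs" "distinct xs" "set xs \<subseteq> A"
  obtains x y z where "u = [x, y, z]" "x \<in> A" "y \<in> A" "z \<in> A"
    "x \<noteq> y" "x \<noteq> z" "y \<noteq> z"
proof -
  have u: "subseq u xs" "length u = 3"
    using assms by (auto simp: subtriples_def)
  obtain x y z where xyz: "u = [x, y, z]"
    using u(2) by (auto simp: eval_nat_numeral length_Suc_conv)
  moreover have "distinct u"
    using u(1) assms(2) by (metis in_set_subseqs subseqs_distinctD)
  moreover have "set u \<subseteq> A"
    using u(1) assms(3) by (auto dest: list_emb_set)
  ultimately show ?thesis
    using that by auto
qed

lemma subtriples_length_4:
  "subtriples [a, b, c, d] = {[a, b, c], [a, b, d], [a, c, d], [b, c, d]}"
proof -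
  have "subtriples [a, b, c, d] = set (filter (\<lambda>u. length u = 3) (subseqs [a, b, c, d]))"
    by (simp add: subtriples_def set_subseqs_eq conj_commute del: subseqs.simps)
  also have "\<dots> = {[a, b, c], [a, b, d], [a, c, d], [b, c, d]}"
    by simp
  finally show ?thesis .
qed

text \<open>With distinct entries, omitting different positions gives different triples. This count
  is later compared with the number of available ratios.\<close>

lemma card_subtriples_length_4:
  assumes "length xs = 4" "distinct xs"
  shows "card (subtriples xs) = 4"
proof -
  obtain a b c d where "xs = [a, b, c, d]"
    using assms(1) by (auto simp: eval_nat_numeral length_Suc_conv)
  then show ?thesis
    using assms(2) by (simp add: subtriples_length_4)
qed

section \<open>Ratios of triples and codes of dimension 2\<close>

context field
begin

text \<open>The slope may be zero, so these maps are exactly the evaluations of polynomials of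
  degree below 2, constants included.\<close>

definition affine :: "'a \<Rightarrow> 'a \<Rightarrow> 'a \<Rightarrow> 'a" where
  "affine a b x = a \<otimes> x \<oplus> b"

text \<open>For a triple \<open>[x, y, z]\<close> with \<open>x \<noteq> y\<close>, this is the
  image of \<open>z\<close> under the affine map sending \<open>x\<close> to \<open>\<zero>\<close>
  and \<open>y\<close> to \<open>\<one>\<close>.\<close>

definition ratio :: "'a list \<Rightarrow> 'a" where
  "ratio u = (u ! 2 \<ominus> u ! 0) \<otimes> inv (u ! 1 \<ominus> u ! 0)"

lemma affine_closed [simp]:
  "\<lbrakk>a \<in> carrier R; b \<in> carrier R; x \<in> carrier R\<rbrakk> \<Longrightarrow> affine a b x \<in> carrier R"
  by (simp add: affine_def)

lemma affine_diff:
  assumes "a \<in> carrier R" "b \<in> carrier R" "x \<in> carrier R" "y \<in> carrier R"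
  shows "affine a b x \<ominus> affine a b y = a \<otimes> (x \<ominus> y)"
  using assms unfolding affine_def by algebra

lemma diff_nonzero:
  assumes "x \<in> carrier R" "y \<in> carrier R" "x \<noteq> y"
  shows "x \<ominus> y \<in> Units R"
  using assms by (simp add: field_Units)

text \<open>Certifies a ratio by one multiplication, so concrete values can be checked without
  computing an inverse.\<close>

lemma ratio_eqI:
  assumes "x \<in> carrier R" "y \<in> carrier R" "x \<noteq> y"
    "t \<in> carrier R" "z \<ominus> x = t \<otimes> (y \<ominus> x)"
  shows "ratio [x, y, z] = t"
  using assms diff_nonzero[of y x]
  by (simp add: ratio_def numeral_2_eq_2 m_assoc Units_r_inv del: One_nat_def)

lemma ratio_closed [simp]:
  assumes "x \<in> carrier R" "y \<in> carrier R" "z \<in> carrier R" "x \<noteq> y"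
  shows "ratio [x, y, z] \<in> carrier R"
  using assms diff_nonzero[of y x] by (simp add: ratio_def)

lemma diff_eq_ratio_mult:
  assumes "x \<in> carrier R" "y \<in> carrier R" "z \<in> carrier R" "x \<noteq> y"
  shows "z \<ominus> x = ratio [x, y, z] \<otimes> (y \<ominus> x)"
  using assms diff_nonzero[of y x]
  by (simp add: ratio_def m_assoc Units_l_inv)

text \<open>A zero ratio would force \<open>z = x\<close>. Together with the exclusion of
  \<open>\<one>\<close> this removes two field elements from the possible ratios.\<close>

lemma ratio_nonzero:
  assumes "x \<in> carrier R" "y \<in> carrier R" "z \<in> carrier R" "x \<noteq> y" "x \<noteq> z"
  shows "ratio [x, y, z] \<noteq> \<zero>"
  using diff_eq_ratio_mult[of x y z] assms by auto

lemma ratio_neq_one: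
  assumes "x \<in> carrier R" "y \<in> carrier R" "z \<in> carrier R" "x \<noteq> y" "y \<noteq> z"
  shows "ratio [x, y, z] \<noteq> \<one>"
proof
  assume "ratio [x, y, z] = \<one>"
  then have "z \<ominus> x = y \<ominus> x"
    using diff_eq_ratio_mult[of x y z] assms by simp
  then have "z = y"
    using assms by (simp add: a_minus_def)
  then show False
    using assms by simp
qed

text \<open>Affine invariance in division-free form: it survives \<open>a = \<zero>\<close>, where
  the image points coincide and both sides vanish.\<close>

lemma ratio_affine:
  assumes "a \<in> carrier R" "b \<in> carrier R" "x \<in> carrier R" "y \<in> carrier R" "z \<in> carrier R" "x \<noteq> y"
  shows "affine a b z \<ominus> affine a b x = ratio [x, y, z] \<otimes> (affine a b y \<ominus> affine a b x)"
proof -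
  let ?t = "ratio [x, y, z]"
  have "affine a b z \<ominus> affine a b x = a \<otimes> (?t \<otimes> (y \<ominus> x))"
    using assms diff_eq_ratio_mult[of x y z] by (simp add: affine_diff)
  also have "\<dots> = ?t \<otimes> (a \<otimes> (y \<ominus> x))"
    using assms by (simp add: m_lcomm)
  finally show ?thesis
    using assms by (simp add: affine_diff)
qed

lemma affine_zero: "\<lbrakk>x \<in> carrier R; b \<in> carrier R\<rbrakk> \<Longrightarrow> affine \<zero> b x = b"
  by (simp add: affine_def)

lemma affine_eq_imp_zero:
  assumes "a \<in> carrier R" "b \<in> carrier R" "x \<in> carrier R" "y \<in> carrier R" "x \<noteq> y"
    "affine a b x = affine a b y"
  shows "a = \<zero>"
proof -
  have "x \<ominus> y \<noteq> \<zero>"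
    using assms by simp
  moreover have "a \<otimes> (x \<ominus> y) = \<zero>"
    using affine_diff[of a b x y] assms by (simp add: a_minus_def r_neg)
  ultimately show ?thesis
    using assms(1,3,4) integral[of a "x \<ominus> y"] by auto
qed

lemma affine_eqI:
  assumes "a \<in> carrier R" "b \<in> carrier R" "c \<in> carrier R" "d \<in> carrier R"
    "x \<in> carrier R" "y \<in> carrier R" "x \<noteq> y"
    "affine a b x = affine c d x" "affine a b y = affine c d y"
  shows "a = c" "b = d"
proof -
  have "a \<otimes> (x \<ominus> y) = c \<otimes> (x \<ominus> y)"
    using assms affine_diff[of a b x y] affine_diff[of c d x y] by simp
  then show "a = c"
    using assms by (simp add: m_rcancel)
  then show "b = d"
    using assms by (simp add: affine_def)
qed

text \<open>Linear interpolation: the slope is the difference quotient, and the value at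
  \<open>x\<close> then fixes the constant term.\<close>

lemma ex_affine_map:
  assumes "x \<in> carrier R" "y \<in> carrier R" "x' \<in> carrier R" "y' \<in> carrier R" "x \<noteq> y"
  obtains a b where "a \<in> carrier R" "b \<in> carrier R" "affine a b x = x'" "affine a b y = y'"
proof -
  have "y \<ominus> x \<in> Units R"
    using assms diff_nonzero by simp
  then obtain a where a: "a \<in> carrier R" "a \<otimes> (y \<ominus> x) = y' \<ominus> x'"
    using assms m_assoc[of "y' \<ominus> x'" "inv (y \<ominus> x)" "y \<ominus> x"]
    by (metis Units_closed Units_inv_closed Units_l_inv m_closed minus_closed r_one)
  define b where "b = x' \<ominus> a \<otimes> x"
  have b: "b \<in> carrier R"
    using a(1) assms by (simp add: b_def)
  have x: "affine a b x = x'"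
    unfolding affine_def b_def using a(1) assms(1,3) by algebra
  have "affine a b y = affine a b x \<oplus> a \<otimes> (y \<ominus> x)"
    unfolding affine_def using a(1) b assms(1,2) by algebra
  also have "\<dots> = y'"
    unfolding x a(2) using assms(3,4) by algebra
  finally show ?thesis
    using that a(1) b x by blast
qed

section \<open>Codes of dimension 2 as affine images of the evaluation vector\<close>

lemma RS_code_2_eq:
  assumes "set \<alpha> \<subseteq> carrier R"
  shows "RS_code R 2 \<alpha> = {map (affine a b) \<alpha> | a b. a \<in> carrier R \<and> b \<in> carrier R}"
    (is "?C = ?A")
proof (intro subset_antisym subsetI)
  fix c assume "c \<in> ?C"
  then obtain f where c: "c = map (eval f) \<alpha>" and f: "polynomial (carrier R) f"
    "f = [] \<or> length f - 1 < 2"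
    by (auto simp: RS_code_def univ_poly_carrier)
  \<comment> \<open>Coefficient lists start with the leading coefficient, so \<open>[a, b]\<close>
    stands for \<open>a x + b\<close>.\<close>
  have "length f \<le> 2"
    using f(2) by auto
  with f(1) consider "f = []" | b where "f = [b]" "b \<in> carrier R"
    | a b where "f = [a, b]" "a \<in> carrier R" "b \<in> carrier R"
    by (auto simp: polynomial_def le_Suc_eq length_Suc_conv numeral_2_eq_2)
  then show "c \<in> ?A"
  proof cases
    case 1
    then have "c = map (affine \<zero> \<zero>) \<alpha>"
      using assms by (auto simp: c affine_def)
    then show ?thesis by blast
  next
    case (2 b)
    then have "c = map (affine \<zero> b) \<alpha>"
      using assms by (auto simp: c affine_def)
    then show ?thesis using 2 by blast
  next
    case (3 a b)
    then have "c = map (affine a b) \<alpha>"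
      using assms by (auto simp: c affine_def)
    then show ?thesis using 3 by blast
  qed
next
  fix c assume "c \<in> ?A"
  then obtain a b where c: "c = map (affine a b) \<alpha>" and ab: "a \<in> carrier R" "b \<in> carrier R"
    by blast
  \<comment> \<open>A polynomial has a nonzero leading coefficient, so leading zeros must be
    dropped.\<close>
  define f where "f = (if a = \<zero> then if b = \<zero> then [] else [b] else [a, b])"
  have "c = map (eval f) \<alpha>"
    using ab assms by (auto simp: c f_def affine_def)
  moreover have "polynomial (carrier R) f" "f = [] \<or> length f - 1 < 2"
    using ab by (auto simp: f_def polynomial_def)
  ultimately show "c \<in> ?C"
    by (auto simp: RS_code_def univ_poly_carrier)
qed

lemma map_affine_in_RS_code:
  assumes "set \<alpha> \<subseteq> carrier R" "a \<in> carrier R" "b \<in> carrier R"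
  shows "map (affine a b) \<alpha> \<in> RS_code R 2 \<alpha>"
  using assms by (auto simp only: RS_code_2_eq)

lemma length_RS_code: "c \<in> RS_code R k \<alpha> \<Longrightarrow> length c = length \<alpha>"
  by (auto simp: RS_code_def)

text \<open>Three shared symbols come from triples \<open>u\<close> and \<open>v\<close> with equal
  images under the two affine maps. Whether or not \<open>u = v\<close>, the two maps turn out to be
  equal.\<close>

lemma LCS_RS_code_2_le:
  assumes \<alpha>: "distinct \<alpha>" "set \<alpha> \<subseteq> carrier R"
    and inj: "inj_on ratio (subtriples \<alpha>)"
    and "c \<in> RS_code R 2 \<alpha>" "c' \<in> RS_code R 2 \<alpha>" "c \<noteq> c'"
  shows "LCS c c' \<le> 2"
  unfolding LCS_le_iff
proof (intro allI impI, rule ccontr)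
  obtain a b where c: "c = map (affine a b) \<alpha>" and ab: "a \<in> carrier R" "b \<in> carrier R"
    using assms by (auto simp: RS_code_2_eq)
  obtain a' b' where c': "c' = map (affine a' b') \<alpha>"
    and ab': "a' \<in> carrier R" "b' \<in> carrier R"
    using assms by (auto simp: RS_code_2_eq)
  fix s assume s: "subseq s c \<and> subseq s c'" and long: "\<not> length s \<le> 2"
  \<comment> \<open>A longer common subsequence is cut down to three terms, the length for which
    ratios are defined.\<close>
  define r where "r = take 3 s"
  have "subseq r s"
    unfolding r_def by (intro prefix_imp_subseq take_is_prefix)
  then have "subseq r c" "subseq r c'"
    using s subseq_order.order_trans by blast+
  moreover have len: "length r = 3"
    using long by (simp add: r_def)
  ultimately obtain u v where u: "subseq u \<alpha>" "r = map (affine a b) u"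
    and v: "subseq v \<alpha>" "r = map (affine a' b') v"
    unfolding c c' by (blast dest: subseq_map_imp)
  have uv: "u \<in> subtriples \<alpha>" "v \<in> subtriples \<alpha>"
    using u v len by (auto simp: subtriples_def dest: arg_cong[of _ _ length])
  obtain x y z where xyz: "u = [x, y, z]" "x \<in> carrier R" "y \<in> carrier R" "z \<in> carrier R"
    "x \<noteq> y" "x \<noteq> z" "y \<noteq> z"
    by (rule subtriplesE[OF uv(1) \<alpha>])
  obtain x' y' z' where xyz': "v = [x', y', z']" "x' \<in> carrier R" "y' \<in> carrier R" "z' \<in> carrier R"
    "x' \<noteq> y'" "x' \<noteq> z'" "y' \<noteq> z'"
    by (rule subtriplesE[OF uv(2) \<alpha>])
  have eq: "affine a b x = affine a' b' x'" "affine a b y = affine a' b' y'"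
    "affine a b z = affine a' b' z'"
    using u(2) v(2) xyz(1) xyz'(1) by auto
  have "a = a' \<and> b = b'"
  proof (cases "u = v")
    \<comment> \<open>The two maps agree at two distinct points.\<close>
    case True
    then show ?thesis
      using affine_eqI[of a b a' b' x y] ab ab' xyz xyz' eq by simp
  next
    case False
    then have "ratio u \<noteq> ratio v"
      using inj uv by (auto dest: inj_onD)
    \<comment> \<open>Both products equal the difference of the third and first shared symbols. As
      the ratios differ, the common factor must vanish, so both maps are constant, and they share a
      value.\<close>
    moreover have "ratio u \<otimes> (affine a b y \<ominus> affine a b x) =
        ratio v \<otimes> (affine a b y \<ominus> affine a b x)"
      using ratio_affine[of a b x y z] ratio_affine[of a' b' x' y' z'] ab ab' xyz xyz' eq
      by simp
    ultimately have "affine a b y \<ominus> affine a b x = \<zero>"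
      using m_rcancel[of "affine a b y \<ominus> affine a b x" "ratio u" "ratio v"] ab xyz xyz'
      by auto
    then have "affine a b x = affine a b y"
      using ab xyz by simp
    then have "a = \<zero>" "a' = \<zero>"
      using affine_eq_imp_zero[of a b x y] affine_eq_imp_zero[of a' b' x' y'] ab ab' xyz xyz' eq
      by auto
    then show ?thesis
      using eq(1) ab ab' xyz xyz' by (simp add: affine_zero)
  qed
  then show False
    using \<open>c \<noteq> c'\<close> c c' by simp
qed

text \<open>If \<open>u\<close> and \<open>v\<close> have equal ratios, the affine map that matches
  their first two entries also matches the third, so it carries \<open>u\<close> to
  \<open>v\<close>.\<close>

lemma LCS_code_RS_2_ge_3:
  assumes \<alpha>: "distinct \<alpha>" "set \<alpha> \<subseteq> carrier R"
    and not_inj: "\<not> inj_on ratio (subtriples \<alpha>)"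
  shows "3 \<le> LCS_code (RS_code R 2 \<alpha>)"
proof -
  obtain u v where uv: "u \<in> subtriples \<alpha>" "v \<in> subtriples \<alpha>" "u \<noteq> v" "ratio u = ratio v"
    using not_inj by (auto simp: inj_on_def)
  obtain x y z where xyz: "u = [x, y, z]" "x \<in> carrier R" "y \<in> carrier R" "z \<in> carrier R"
    "x \<noteq> y" "x \<noteq> z" "y \<noteq> z"
    by (rule subtriplesE[OF uv(1) \<alpha>])
  obtain x' y' z' where xyz': "v = [x', y', z']" "x' \<in> carrier R" "y' \<in> carrier R" "z' \<in> carrier R"
    "x' \<noteq> y'" "x' \<noteq> z'" "y' \<noteq> z'"
    by (rule subtriplesE[OF uv(2) \<alpha>])
  obtain a b where ab: "a \<in> carrier R" "b \<in> carrier R"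
    and eq: "affine a b x = x'" "affine a b y = y'"
    by (rule ex_affine_map[OF xyz(2,3) xyz'(2,3) xyz(5)])
  have "affine a b z \<ominus> x' = z' \<ominus> x'"
    using ratio_affine[of a b x y z] diff_eq_ratio_mult[of x' y' z'] ab xyz xyz' eq uv(4)
    by simp
  then have "affine a b z = z'"
    using ab xyz xyz' by (simp add: a_minus_def)
  then have map_u: "map (affine a b) u = v"
    using xyz xyz' eq by simp
  \<comment> \<open>The second codeword is \<open>\<alpha>\<close> itself and contains
    \<open>v\<close>; the first is the image of \<open>\<alpha>\<close> and contains the image of
    \<open>u\<close>, which is again \<open>v\<close>.\<close>
  let ?c = "map (affine a b) \<alpha>" and ?c' = "map (affine \<one> \<zero>) \<alpha>"
  have id: "?c' = \<alpha>"
    using \<alpha>(2) by (intro map_idI) (auto simp: affine_def)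
  \<comment> \<open>Equality would make the map fix every entry of \<open>\<alpha>\<close>, hence
    fix \<open>u\<close>, although it sends \<open>u\<close> to \<open>v \<noteq> u\<close>.\<close>
  have "?c \<noteq> ?c'"
  proof
    assume "?c = ?c'"
    then have "affine a b w = w" if "w \<in> set \<alpha>" for w
      using that unfolding id by (metis map_eq_conv map_ident)
    moreover have "set u \<subseteq> set \<alpha>"
      using uv(1) by (auto simp: subtriples_def dest: list_emb_set)
    ultimately have "map (affine a b) u = u"
      by (intro map_idI) auto
    then show False
      using map_u uv(3) by simp
  qed
  moreover have "?c \<in> RS_code R 2 \<alpha>" "?c' \<in> RS_code R 2 \<alpha>"
    using \<alpha>(2) ab by (simp_all add: map_affine_in_RS_code)
  ultimately have "LCS ?c ?c' \<le> LCS_code (RS_code R 2 \<alpha>)"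
    by (intro LCS_le_LCS_code) (auto dest: length_RS_code)
  moreover have "subseq v ?c"
    using uv(1) map_u subseq_map[of u \<alpha> "affine a b"] by (simp add: subtriples_def)
  then have "length v \<le> LCS ?c ?c'"
    using uv(2) id by (intro length_le_LCS) (auto simp: subtriples_def)
  ultimately show ?thesis
    using xyz'(1) by simp
qed

section \<open>Lower bound on the field size\<close>

lemma card_subtriples_le:
  assumes \<alpha>: "distinct \<alpha>" "set \<alpha> \<subseteq> carrier R"
    and fin: "finite (carrier R)" and inj: "inj_on ratio (subtriples \<alpha>)"
  shows "card (subtriples \<alpha>) \<le> order R - 2"
proof -
  have "ratio u \<in> carrier R - {\<zero>, \<one>}" if u: "u \<in> subtriples \<alpha>" for u
  proof -
    obtain x y z where "u = [x, y, z]" "x \<in> carrier R" "y \<in> carrier R" "z \<in> carrier R"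
      "x \<noteq> y" "x \<noteq> z" "y \<noteq> z"
      by (rule subtriplesE[OF u \<alpha>])
    then show ?thesis
      by (simp add: ratio_nonzero ratio_neq_one)
  qed
  \<comment> \<open>Pigeonhole: \<open>ratio\<close> injects the triples into the field without
    \<open>\<zero>\<close> and \<open>\<one>\<close>.\<close>
  then have "card (subtriples \<alpha>) \<le> card (carrier R - {\<zero>, \<one>})"
    using fin by (intro card_inj_on_le[OF inj]) auto
  also have "\<dots> = order R - 2"
    by (subst card_Diff_subset) (auto simp: order_def)
  finally show ?thesis .
qed

lemma optimal_RS_4_2_imp_order_ge:
  assumes "primepow (order R)" "optimal_RS R 4 2 \<alpha>"
  shows "7 \<le> order R"
proof -
  have \<alpha>: "length \<alpha> = 4" "distinct \<alpha>" "set \<alpha> \<subseteq> carrier R"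
    and LCS: "LCS_code (RS_code R 2 \<alpha>) = 2"
    using assms(2) by (auto simp: optimal_RS_def evaluation_vector_def optimal_code_def)
  \<comment> \<open>An infinite carrier has \<open>order\<close> 0, whereas prime powers are
    positive.\<close>
  have fin: "finite (carrier R)"
    using assms(1) primepow_gt_0_nat[of "order R"] by (auto simp: order_gt_0_iff_finite)
  have inj: "inj_on ratio (subtriples \<alpha>)"
    using LCS_code_RS_2_ge_3[OF \<alpha>(2,3)] LCS by fastforce
  \<comment> \<open>The left side is positive, so truncated subtraction does no harm and the order
    is at least 6.\<close>
  have "4 \<le> order R - 2"
    using card_subtriples_le[OF \<alpha>(2,3) fin inj] card_subtriples_length_4[OF \<alpha>(1,2)] by simp
  moreover have "order R \<noteq> 6"
  proof
    assume "order R = 6"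
    then obtain p k where pk: "prime p" "(6::nat) = p ^ k"
      using assms(1) by (auto simp: primepow_def)
    \<comment> \<open>If 6 were a power of a prime \<open>p\<close>, both 2 and 3 would divide
      \<open>p\<close> and hence equal it.\<close>
    then have "2 dvd p ^ k" "3 dvd p ^ k"
      by (auto simp flip: pk(2))
    then have "2 dvd p" "3 dvd p"
      by (simp_all add: prime_dvd_power)
    then have "p = 2" "p = 3"
      using pk(1) primes_dvd_imp_eq[of 2 p] primes_dvd_imp_eq[of 3 p] by simp_all
    then show False
      by simp
  qed
  ultimately show ?thesis
    by simp
qed

end

section \<open>An optimal code over the field with seven elements\<close>

lemma field_residue_ring_7: "field (residue_ring 7)"
proof -
  interpret residues_prime 7 "residue_ring (int 7)"
    by unfold_locales simp_all
  show ?thesis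
    using field_axioms by simp
qed

lemma order_residue_ring_7: "order (residue_ring 7) = 7"
  by (simp add: order_def residue_ring_def)

lemma optimal_RS_residue_ring_7: "optimal_RS (residue_ring 7) 4 2 [0, 1, 2, 5]"
proof -
  interpret residues 7 "residue_ring 7"
    by unfold_locales simp_all
  interpret F: field "residue_ring 7"
    by (rule field_residue_ring_7)
  let ?R = "residue_ring 7" and ?\<alpha> = "[0, 1, 2, 5] :: int list"
  note arith = res_carrier_eq res_add_eq res_mult_eq res_neg_eq a_minus_def
  have \<alpha>: "distinct ?\<alpha>" "set ?\<alpha> \<subseteq> carrier ?R"
    by (simp_all add: res_carrier_eq)
  \<comment> \<open>Only the third triple has a denominator other than 1: there
    \<open>6 * 2 = 12\<close>, which is 5 modulo 7.\<close>
  have "F.ratio [0, 1, 2] = 2" "F.ratio [0, 1, 5] = 5" "F.ratio [0, 2, 5] = 6"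
    "F.ratio [1, 2, 5] = 4"
    by (rule F.ratio_eqI; simp add: arith)+
  then have inj: "inj_on F.ratio (subtriples ?\<alpha>)"
    by (simp add: subtriples_length_4)
  \<comment> \<open>The codewords of \<open>x\<close> and \<open>x + 1\<close> share
    \<open>[1, 2]\<close>, which gives the lower bound 2 directly. The same pair supplies the
    nonemptiness needed for the upper bound.\<close>
  let ?c = "map (F.affine 1 0) ?\<alpha>" and ?c' = "map (F.affine 1 1) ?\<alpha>"
  have cc'_mem: "?c \<in> RS_code ?R 2 ?\<alpha>" "?c' \<in> RS_code ?R 2 ?\<alpha>"
    by (rule F.map_affine_in_RS_code; simp add: res_carrier_eq)+
  have cc'_eq: "?c = [0, 1, 2, 5]" "?c' = [1, 2, 3, 6]"
    by (simp_all add: F.affine_def arith)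
  have cc'_neq: "?c \<noteq> ?c'"
    unfolding cc'_eq by simp
  have "length [1, 2 :: int] \<le> LCS ?c ?c'"
    unfolding cc'_eq by (rule length_le_LCS) simp_all
  moreover have "LCS ?c ?c' \<le> LCS_code (RS_code ?R 2 ?\<alpha>)"
    by (rule LCS_le_LCS_code[OF F.length_RS_code cc'_mem cc'_neq])
  moreover have "LCS_code (RS_code ?R 2 ?\<alpha>) \<le> 2"
    by (rule LCS_code_le[OF F.length_RS_code cc'_mem cc'_neq F.LCS_RS_code_2_le[OF \<alpha> inj]])
  ultimately show ?thesis
    using \<alpha> by (simp add: optimal_RS_def evaluation_vector_def optimal_code_def)
qed

text \<open>HOL has no existential quantifier over types, so the minimum ranges over fields carried
  by \<open>int\<close>, where \<open>residue_ring 7\<close> lives. The second conjunct gives the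
  lower bound for an arbitrary carrier type.\<close>

theorem lemma6:
  shows "(LEAST q::nat. primepow q \<and>
            (\<exists>F :: int ring. field F \<and> order F = q \<and> (\<exists>\<alpha>. optimal_RS F 4 2 \<alpha>))) = 7
    \<and> (\<forall>F :: ('a, 'm) ring_scheme.
         field F \<and> primepow (order F) \<and> (\<exists>\<alpha>. optimal_RS F 4 2 \<alpha>) \<longrightarrow> 7 \<le> order F)
    \<and> primepow (7::nat) \<and> field (residue_ring 7) \<and> order (residue_ring 7) = 7
    \<and> optimal_RS (residue_ring 7) 4 2 [0, 1, 2, 5]"
proof (intro conjI)
  show primepow_7: "primepow (7::nat)"
    by simp
  show "(LEAST q::nat. primepow q \<and>
            (\<exists>F :: int ring. field F \<and> order F = q \<and> (\<exists>\<alpha>. optimal_RS F 4 2 \<alpha>))) = 7"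
    using primepow_7 field_residue_ring_7 order_residue_ring_7 optimal_RS_residue_ring_7
    by (intro Least_equality) (blast intro: field.optimal_RS_4_2_imp_order_ge)+
qed (use field_residue_ring_7 order_residue_ring_7 optimal_RS_residue_ring_7 in
      \<open>auto intro: field.optimal_RS_4_2_imp_order_ge\<close>)

end
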